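(* Let $f=h\oslash g$ be a tropical meromorphic function with $f(0)=1_\circ=0$, where $g,h$ are tropical entire functions without common roots, so that $\mathbf{f}=(g,h)$ is a reduced representation of the tropical holomorphic curve $\mathbb{R}\to\mathbb{TP}^1$ given by $f=[g:h]$. Then $$T_{\mathbf{f}}(r)=T_f(r)=T(r,f),$$ where $T_{\mathbf{f}}(r)=T_f(r)$ is the tropical Cartan characteristic function of the curve $[g:h]$ and $T(r,f)$ is the tropical Nevanlinna characteristic function of $f$.
   Context: Tropical arithmetic: $\mathbb{R}_{\max}=\mathbb{R}\cup\{-\infty\}$, $1_\circ=0$, $a\oplus b=\max\{a,b\}$, $a\odot b=a+b$, $a\oslash b=a-b$; operations on functions are pointwise. A tropical meromorphic function is a continuous piecewise linear function $f:\mathbb{R}\to\mathbb{R}$ (real slopes; the points where the slope changes form a discrete set with no finite limit points). Put $\omega_f(x)=\lim_{\varepsilon\to0+}(f'(x+\varepsilon)-f'(x-\varepsilon))$. A point $x$ is a pole of $f$ if $\omega_f(x)<0$ and a root if $\omega_f(x)>0$, with multiplicity $|\omega_f(x)|$. A tropical entire function is a tropical meromorphic function without poles. Nevanlinna functions: $m(r,f)=\frac12(f^+(r)+f^+(-r))$ with $f^+(x)=\max\{0,f(x)\}$; $n(t,f)=\sum_{|s|\le t,\ \omega_f(s)<0}|\omega_f(s)|$; $N(r,f)=\frac12\int_0^r n(t,f)\,dt$; $T(r,f)=m(r,f)+N(r,f)$. $\mathbb{TP}^1$ is the quotient of $\mathbb{R}_{\max}^2\setminus\{(-\infty,-\infty)\}$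 by $(a_0,a_1)\sim(\lambda+a_0,\lambda+a_1)$, $\lambda\in\mathbb{R}$; a reduced representation of a curve $[g:h]:\mathbb{R}\to\mathbb{TP}^1$ is a pair $(g,h)$ of tropical entire functions with no common root. Tropical Cartan characteristic: $T_{\mathbf{f}}(r)=\frac12(F(r)+F(-r))-F(0)$ with $F(x)=\max\{g(x),h(x)\}$; $T_f(r)$ denotes the same quantity (it does not depend on the reduced representation). *)

theory Defs
  imports "HOL-Analysis.Analysis"
begin

section \<open>Tropical meromorphic functions\<close>

text \<open>
  The set \<open>S\<close> contains the points where the slope changes; having no limit point in
  the real line, it is closed and discrete, and the function is affine on every open interval
  that avoids it.
\<close>
definition tropical_meromorphic :: "(real \<Rightarrow> real) \<Rightarrow> bool" where
  "tropical_meromorphic f \<longleftrightarrow>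
     continuous_on UNIV f \<and>
     (\<exists>S. (\<forall>x. \<not> x islimpt S) \<and>
          (\<forall>u v. {u<..<v} \<inter> S = {} \<longrightarrow> (\<exists>a b. \<forall>x\<in>{u<..<v}. f x = a * x + b)))"

definition slope_jump :: "(real \<Rightarrow> real) \<Rightarrow> real \<Rightarrow> real" where
  "slope_jump f x = Lim (at_right 0) (\<lambda>\<epsilon>. deriv f (x + \<epsilon>) - deriv f (x - \<epsilon>))"

definition tropical_pole :: "(real \<Rightarrow> real) \<Rightarrow> real \<Rightarrow> bool" where
  "tropical_pole f x \<longleftrightarrow> slope_jump f x < 0"

definition tropical_root :: "(real \<Rightarrow> real) \<Rightarrow> real \<Rightarrow> bool" where
  "tropical_root f x \<longleftrightarrow> slope_jump f x > 0"

definition tropical_entire :: "(real \<Rightarrow> real) \<Rightarrow> bool" where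
  "tropical_entire f \<longleftrightarrow> tropical_meromorphic f \<and> (\<forall>x. \<not> tropical_pole f x)"

definition no_common_root :: "(real \<Rightarrow> real) \<Rightarrow> (real \<Rightarrow> real) \<Rightarrow> bool" where
  "no_common_root g h \<longleftrightarrow> (\<forall>x. \<not> (tropical_root g x \<and> tropical_root h x))"

section \<open>Nevanlinna functions\<close>

definition proximity :: "real \<Rightarrow> (real \<Rightarrow> real) \<Rightarrow> real" where
  "proximity r f = (max 0 (f r) + max 0 (f (- r))) / 2"

definition pole_count :: "real \<Rightarrow> (real \<Rightarrow> real) \<Rightarrow> real" where
  "pole_count t f = (\<Sum>s\<in>{s. \<bar>s\<bar> \<le> t \<and> tropical_pole f s}. \<bar>slope_jump f s\<bar>)"

definition integrated_pole_count :: "real \<Rightarrow> (real \<Rightarrow> real) \<Rightarrow> real" where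
  "integrated_pole_count r f = integral {0..r} (\<lambda>t. pole_count t f) / 2"

definition nevanlinna_characteristic :: "real \<Rightarrow> (real \<Rightarrow> real) \<Rightarrow> real" where
  "nevanlinna_characteristic r f = proximity r f + integrated_pole_count r f"

section \<open>The tropical projective line and the Cartan characteristic\<close>

text \<open>The tropical semiring is represented by the extended reals other than \<open>\<infinity>\<close>.\<close>
definition tp1_coords :: "(ereal \<times> ereal) set" where
  "tp1_coords = {(a0, a1). a0 \<noteq> \<infinity> \<and> a1 \<noteq> \<infinity>} - {(- \<infinity>, - \<infinity>)}"

definition tp1_rel :: "((ereal \<times> ereal) \<times> (ereal \<times> ereal)) set" where
  "tp1_rel = {((a0, a1), (b0, b1)). (a0, a1) \<in> tp1_coords \<and> (b0, b1) \<in> tp1_coords \<and>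
     (\<exists>l::real. b0 = ereal l + a0 \<and> b1 = ereal l + a1)}"

lemma equiv_tp1_rel: "equiv tp1_coords tp1_rel"
proof (rule equivI)
  show "tp1_rel \<subseteq> tp1_coords \<times> tp1_coords"
    by (auto simp: tp1_rel_def)
  show "refl_on tp1_coords tp1_rel"
    by (auto simp: refl_on_def tp1_rel_def intro!: exI[of _ 0] simp flip: zero_ereal_def)
  show "sym tp1_rel"
  proof (rule symI)
    fix p q :: "ereal \<times> ereal" assume "(p, q) \<in> tp1_rel"
    then obtain a0 a1 l where "p = (a0, a1)" "q = (ereal l + a0, ereal l + a1)"
      and "p \<in> tp1_coords" "q \<in> tp1_coords"
      by (auto simp: tp1_rel_def)
    moreover have "a = ereal (- l) + (ereal l + a)" for a
      by (cases a) auto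
    ultimately show "(q, p) \<in> tp1_rel"
      unfolding tp1_rel_def by blast
  qed
  show "trans tp1_rel"
  proof (rule transI)
    fix p q s :: "ereal \<times> ereal" assume "(p, q) \<in> tp1_rel" "(q, s) \<in> tp1_rel"
    then obtain a0 a1 l k where "p = (a0, a1)"
      "s = (ereal k + (ereal l + a0), ereal k + (ereal l + a1))"
      and "p \<in> tp1_coords" "s \<in> tp1_coords"
      by (auto simp: tp1_rel_def)
    moreover have "ereal k + (ereal l + a) = ereal (k + l) + a" for a
      by (cases a) auto
    ultimately show "(p, s) \<in> tp1_rel"
      unfolding tp1_rel_def by blast
  qed
qed

definition TP1 :: "(ereal \<times> ereal) set set" where
  "TP1 = tp1_coords // tp1_rel"

text \<open>The curve with homogeneous coordinates \<open>[g : h]\<close>.\<close>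
definition tp1_curve :: "(real \<Rightarrow> real) \<Rightarrow> (real \<Rightarrow> real) \<Rightarrow> real \<Rightarrow> (ereal \<times> ereal) set" where
  "tp1_curve g h x = tp1_rel `` {(ereal (g x), ereal (h x))}"

lemma tp1_curve_in_TP1: "tp1_curve g h x \<in> TP1"
  by (auto simp: tp1_curve_def TP1_def tp1_coords_def intro!: quotientI)

definition reduced_representation ::
    "(real \<Rightarrow> (ereal \<times> ereal) set) \<Rightarrow> (real \<Rightarrow> real) \<Rightarrow> (real \<Rightarrow> real) \<Rightarrow> bool" where
  "reduced_representation c g h \<longleftrightarrow>
     tropical_entire g \<and> tropical_entire h \<and> no_common_root g h \<and> c = tp1_curve g h"

definition cartan_characteristic_pair ::
    "(real \<Rightarrow> real) \<Rightarrow> (real \<Rightarrow> real) \<Rightarrow> real \<Rightarrow> real" where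
  "cartan_characteristic_pair g h r =
     (let F = (\<lambda>x. max (g x) (h x)) in (F r + F (- r)) / 2 - F 0)"

text \<open>
  The characteristic of a curve is the common value over all its reduced representations.
\<close>
definition cartan_characteristic :: "(real \<Rightarrow> (ereal \<times> ereal) set) \<Rightarrow> real \<Rightarrow> real" where
  "cartan_characteristic c r =
     (THE T. \<exists>g h. reduced_representation c g h \<and> T = cartan_characteristic_pair g h r)"

end

theory Submission
  imports Defs
begin

text \<open>
  Write \<open>max (g x) (h x) = g x + max 0 (f x)\<close>. Since \<open>f 0 = 0\<close>, the function
  \<open>F = max g h\<close> agrees with \<open>g\<close> at \<open>0\<close>, and the Cartan characteristic of
  the pair splits into the proximity function of \<open>f\<close> and the remainder
  \<open>(g r + g (- r)) / 2 - g 0\<close>. It has to be seen that this remainder is the integrated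
  counting function of the poles of \<open>f\<close>.

  This rests on the tropical Jensen formula (lemma \<open>tropical_jensen\<close>): the
  derivative of \<open>g t + g (- t)\<close> is the difference of the slopes of \<open>g\<close> at
  \<open>t\<close> and at \<open>- t\<close>, which is the sum of the slope jumps of \<open>g\<close> in between;
  integration over \<open>{0..r}\<close> gives \<open>g r + g (- r) - 2 * g 0\<close>. For entire \<open>g\<close> and
  \<open>h\<close> without common roots, no root of \<open>g\<close> is cancelled in \<open>f = h - g\<close>, and
  these roots are exactly the poles of \<open>f\<close>, with the same multiplicities (lemma
  \<open>pole_count_quotient\<close>).

  That the characteristic of the curve is well defined then comes for free: the class of
  \<open>(g x, h x)\<close> in the projective line determines \<open>h x - g x\<close>, so every reduced
  representation of the curve has the same quotient \<open>f\<close>, and its characteristic equals the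
  Nevanlinna characteristic of that \<open>f\<close>.
\<close>

section \<open>Local structure of piecewise linear functions\<close>

text \<open>
  \<open>p\<close> is the slope just to the left of \<open>x\<close> and \<open>q\<close> the slope just to the right; the
  two may coincide, so that every point of a piecewise linear function is covered.
\<close>
definition kink :: "(real \<Rightarrow> real) \<Rightarrow> real \<Rightarrow> real \<Rightarrow> real \<Rightarrow> bool" where
  "kink f x p q \<longleftrightarrow>
     (\<exists>e>0. \<forall>y. \<bar>y - x\<bar> < e \<longrightarrow> f y = f x + (if y < x then p else q) * (y - x))"

lemma affine_extends_to_endpoint:
  fixes f :: "real \<Rightarrow> real"
  assumes "continuous_on UNIV f" "x islimpt I" "\<And>y. y \<in> I \<Longrightarrow> f y = a * y + b"
  shows "f x = a * x + b"
proof -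
  have lim: "(f \<longlongrightarrow> f x) (at x within I)"
    using assms(1) by (meson continuous_on_def UNIV_I subset_UNIV tendsto_within_subset)
  have "((\<lambda>y. a * y + b) \<longlongrightarrow> a * x + b) (at x within I)"
    by (intro tendsto_intros)
  moreover have "\<forall>\<^sub>F y in at x within I. a * y + b = f y"
    using assms(3) by (auto simp: eventually_at_filter)
  ultimately have "(f \<longlongrightarrow> a * x + b) (at x within I)"
    by (rule Lim_transform_eventually)
  then show ?thesis
    using tendsto_unique[OF _ lim] assms(2) by (simp add: trivial_limit_within)
qed

text \<open>
  As \<open>x\<close> is not a limit point of the set of slope changes, two one-sided open intervals at
  \<open>x\<close> avoid that set. The function is affine on each of them, and by continuity both affine
  expressions have the value \<open>f x\<close> at \<open>x\<close>.
\<close>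
lemma tropical_meromorphic_kink:
  assumes "tropical_meromorphic f"
  obtains p q where "kink f x p q"
proof -
  from assms obtain S where cont: "continuous_on UNIV f" and S: "\<not> x islimpt S"
    and aff: "\<And>u v. {u<..<v} \<inter> S = {} \<Longrightarrow> \<exists>a b. \<forall>x\<in>{u<..<v}. f x = a * x + b"
    unfolding tropical_meromorphic_def by blast
  obtain e where e: "e > 0" "\<And>y. y \<in> S \<Longrightarrow> y \<noteq> x \<Longrightarrow> \<not> dist y x < e"
    using S by (auto simp: islimpt_approachable)
  have "{x - e<..<x} \<inter> S = {}" "{x<..<x + e} \<inter> S = {}"
    using e(2) by (force simp: dist_real_def)+
  then obtain p b q c
    where l: "\<And>y. y \<in> {x - e<..<x} \<Longrightarrow> f y = p * y + b"
      and r: "\<And>y. y \<in> {x<..<x + e} \<Longrightarrow> f y = q * y + c"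
    using aff by meson
  have xl: "f x = p * x + b"
    using e(1) by (intro affine_extends_to_endpoint[OF cont islimpt_greaterThanLessThan2[of "x - e" x]] l) auto
  have xr: "f x = q * x + c"
    using e(1) by (intro affine_extends_to_endpoint[OF cont islimpt_greaterThanLessThan1[of x "x + e"]] r) auto
  have "f y = f x + (if y < x then p else q) * (y - x)" if "\<bar>y - x\<bar> < e" for y
  proof (cases y x rule: linorder_cases)
    case less
    then have "f y = p * y + b" using l[of y] that by simp
    then show ?thesis using xl less by (simp add: algebra_simps)
  next
    case greater
    then have "f y = q * y + c" using r[of y] that by simp
    then show ?thesis using xr greater by (simp add: algebra_simps)
  qed simp
  then have "kink f x p q"
    using e(1) unfolding kink_def by blast
  then show ?thesis by (rule that)
qed

lemma kink_diff:
  assumes "kink h x p q" "kink g x p' q'"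
  shows "kink (\<lambda>x. h x - g x) x (p - p') (q - q')"
proof -
  obtain d where d: "d > 0"
    and h: "\<And>y. \<bar>y - x\<bar> < d \<Longrightarrow> h y = h x + (if y < x then p else q) * (y - x)"
    using assms(1) unfolding kink_def by blast
  obtain e where e: "e > 0"
    and g: "\<And>y. \<bar>y - x\<bar> < e \<Longrightarrow> g y = g x + (if y < x then p' else q') * (y - x)"
    using assms(2) unfolding kink_def by blast
  have "h y - g y = h x - g x + (if y < x then p - p' else q - q') * (y - x)"
    if "\<bar>y - x\<bar> < min d e" for y
    using h[of y] g[of y] that by (auto simp: algebra_simps)
  moreover have "min d e > 0" using d e by simp
  ultimately show ?thesis unfolding kink_def by blast
qed

lemma kink_nearby:
  assumes "kink f x p q"
  shows "\<exists>e>0. (\<forall>y\<in>{x - e<..<x}. kink f y p p) \<and> (\<forall>y\<in>{x<..<x + e}. kink f y q q)"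
proof -
  obtain e where e: "e > 0"
    "\<And>y. \<bar>y - x\<bar> < e \<Longrightarrow> f y = f x + (if y < x then p else q) * (y - x)"
    using assms unfolding kink_def by blast
  have "kink f y p p" if "x - e < y" "y < x" for y
    unfolding kink_def
  proof (intro exI[of _ "min (x - y) (y - (x - e))"] conjI allI impI)
    fix z assume "\<bar>z - y\<bar> < min (x - y) (y - (x - e))"
    then show "f z = f y + (if z < y then p else p) * (z - y)"
      using that e(2)[of z] e(2)[of y] by (simp add: algebra_simps abs_if split: if_splits)
  qed (use that in auto)
  moreover have "kink f y q q" if "x < y" "y < x + e" for y
    unfolding kink_def
  proof (intro exI[of _ "min (y - x) (x + e - y)"] conjI allI impI)
    fix z assume "\<bar>z - y\<bar> < min (y - x) (x + e - y)"
    then show "f z = f y + (if z < y then q else q) * (z - y)"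
      using that e(2)[of z] e(2)[of y] by (simp add: algebra_simps abs_if split: if_splits)
  qed (use that in auto)
  ultimately show ?thesis
    using e(1) by (intro exI[of _ e]) simp
qed

lemma kink_smooth_derivative:
  assumes "kink f x p p"
  shows "(f has_real_derivative p) (at x)"
proof -
  obtain e where e: "e > 0" "\<And>y. \<bar>y - x\<bar> < e \<Longrightarrow> f y = f x + p * (y - x)"
    using assms unfolding kink_def by auto
  have "((\<lambda>y. f x + p * (y - x)) has_real_derivative p) (at x)"
    by (auto intro!: derivative_eq_intros)
  moreover have "f x + p * (y - x) = f y" if "dist y x < e" for y
    using e(2)[of y] that by (simp add: dist_real_def)
  ultimately show ?thesis
    using has_field_derivative_transform_within[OF _ e(1) UNIV_I] by blast
qed

lemma kink_slope_jump:
  assumes "kink f x p q"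
  shows "slope_jump f x = q - p"
proof -
  obtain e where e: "e > 0" "\<And>y. y \<in> {x - e<..<x} \<Longrightarrow> kink f y p p"
    "\<And>y. y \<in> {x<..<x + e} \<Longrightarrow> kink f y q q"
    using kink_nearby[OF assms] by blast
  have "deriv f (x + t) - deriv f (x - t) = q - p" if "0 < t" "t < e" for t
    using that by (simp add: DERIV_imp_deriv[OF kink_smooth_derivative[OF e(2)]]
        DERIV_imp_deriv[OF kink_smooth_derivative[OF e(3)]])
  then have "\<forall>\<^sub>F t in at_right 0. deriv f (x + t) - deriv f (x - t) = q - p"
    using e(1) unfolding eventually_at_right_field by blast
  then show ?thesis
    unfolding slope_jump_def by (rule tendsto_Lim[OF trivial_limit_at_right_real tendsto_eventually])
qed

section \<open>Slopes as sums of jumps\<close>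

definition right_slope :: "(real \<Rightarrow> real) \<Rightarrow> real \<Rightarrow> real" where
  "right_slope f x = Lim (at_right x) (deriv f)"

lemma kink_right_slope:
  assumes "kink f x p q"
  shows "right_slope f x = q"
proof -
  obtain e where e: "e > 0" "\<And>y. y \<in> {x<..<x + e} \<Longrightarrow> kink f y q q"
    using kink_nearby[OF assms] by blast
  have "deriv f y = q" if "x < y" "y < x + e" for y
    using that by (simp add: DERIV_imp_deriv[OF kink_smooth_derivative[OF e(2)]])
  then have "\<forall>\<^sub>F y in at_right x. deriv f y = q"
    using eventually_at_right_real[of x "x + e"] e(1) by (auto elim: eventually_mono)
  then show ?thesis
    unfolding right_slope_def by (rule tendsto_Lim[OF trivial_limit_at_right_real tendsto_eventually])
qed

text \<open>
  Measuring slopes from the right and jumps on half-open intervals makes the claim additive in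
  adjacent intervals, with no exceptional end points. By bisection it then suffices to treat
  short intervals around each point, where at most one jump occurs. Finiteness of the
  set of jumps is carried along in the same induction, since the sum is meaningful only with it.
\<close>
lemma right_slope_eq_sum_jumps:
  assumes f: "tropical_meromorphic f" and "a \<le> b"
  shows "finite {s\<in>{a<..b}. slope_jump f s \<noteq> 0} \<and>
    right_slope f b - right_slope f a = (\<Sum>s | s \<in> {a<..b} \<and> slope_jump f s \<noteq> 0. slope_jump f s)"
    (is "?P a b")
proof (rule Bolzano[where P = ?P, OF \<open>a \<le> b\<close>])
  fix a b c :: real
  assume P: "?P a b" "?P b c" and "a \<le> b" "b \<le> c"
  let ?J = "\<lambda>a b. {s. s \<in> {a<..b} \<and> slope_jump f s \<noteq> 0}"
  have eq: "?J a c = ?J a b \<union> ?J b c" using \<open>a \<le> b\<close> \<open>b \<le> c\<close> by auto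
  have "sum (slope_jump f) (?J a c) = sum (slope_jump f) (?J a b) + sum (slope_jump f) (?J b c)"
    unfolding eq using P by (intro sum.union_disjoint) auto
  then show "?P a c" using P eq by simp
next
  fix x :: real
  obtain p q where k: "kink f x p q" using tropical_meromorphic_kink[OF f] .
  obtain e where e: "e > 0" "\<And>y. y \<in> {x - e<..<x} \<Longrightarrow> kink f y p p"
    "\<And>y. y \<in> {x<..<x + e} \<Longrightarrow> kink f y q q"
    using kink_nearby[OF k] by blast
  have "?P a b" if "a \<le> x" "x \<le> b" "b - a < e" for a b
  proof -
    have zero: "slope_jump f s = 0" if "x - e < s" "s < x + e" "s \<noteq> x" for s
      using kink_slope_jump[OF e(2), of s] kink_slope_jump[OF e(3), of s] that
      by (cases s x rule: linorder_cases) auto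
    have rb: "right_slope f b = q"
      using kink_right_slope[OF k] kink_right_slope[OF e(3), of b] that by (cases "b = x") auto
    have "s \<in> {a<..b} \<and> slope_jump f s \<noteq> 0 \<longleftrightarrow> s = x \<and> a < x \<and> slope_jump f x \<noteq> 0" for s
      using zero[of s] that by (cases "s = x") auto
    then have sub: "{s. s \<in> {a<..b} \<and> slope_jump f s \<noteq> 0} =
        (if a < x \<and> slope_jump f x \<noteq> 0 then {x} else {})"
      by auto
    have ra: "right_slope f a = (if a < x then p else q)"
      using kink_right_slope[OF k] kink_right_slope[OF e(2), of a] that by (cases "a = x") auto
    show ?thesis
      unfolding sub ra rb using kink_slope_jump[OF k] by auto
  qed
  then show "\<exists>d>0. \<forall>a b. a \<le> x \<and> x \<le> b \<and> b - a < d \<longrightarrow> ?P a b"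
    using e(1) by blast
qed

section \<open>The Jensen formula\<close>

text \<open>
  Roots enter with positive sign and poles with negative sign. The function
  \<open>f t + f (- t)\<close> is an antiderivative of the integrand away from the finitely many
  \<open>t\<close> for which \<open>t\<close> or \<open>- t\<close> is a point of slope change, and it is
  continuous, so the fundamental theorem of calculus applies.
\<close>
lemma tropical_jensen:
  assumes f: "tropical_meromorphic f" and "r \<ge> 0"
  shows "((\<lambda>t. \<Sum>s | \<bar>s\<bar> \<le> t \<and> slope_jump f s \<noteq> 0. slope_jump f s)
    has_integral f r + f (- r) - 2 * f 0) {0..r}"
proof -
  let ?n = "\<lambda>t. \<Sum>s | \<bar>s\<bar> \<le> t \<and> slope_jump f s \<noteq> 0. slope_jump f s"
  let ?J = "{s\<in>{- r<..r}. slope_jump f s \<noteq> 0}"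
  have cont: "continuous_on A f" for A
    using f continuous_on_subset unfolding tropical_meromorphic_def by blast
  have "finite ?J" using right_slope_eq_sum_jumps[OF f, of "- r" r] \<open>r \<ge> 0\<close> by simp
  then have fin: "finite (?J \<union> uminus ` ?J)" by simp
  have smooth: "(f has_real_derivative right_slope f x) (at x)" if "slope_jump f x = 0" for x
  proof -
    obtain p q where k: "kink f x p q" using tropical_meromorphic_kink[OF f] .
    then show ?thesis
      using kink_slope_jump[OF k] kink_right_slope[OF k] kink_smooth_derivative[of f x q] that by simp
  qed
  have deriv: "((\<lambda>t. f t + f (- t)) has_vector_derivative ?n t) (at t)"
    if t: "t \<in> {0<..<r} - (?J \<union> uminus ` ?J)" for t
  proof -
    have jump: "slope_jump f t = 0" "slope_jump f (- t) = 0"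
    proof -
      show "slope_jump f t = 0" using t by auto
      show "slope_jump f (- t) = 0"
      proof (rule ccontr)
        assume "slope_jump f (- t) \<noteq> 0"
        then have "- t \<in> ?J" using t by auto
        then have "- (- t) \<in> uminus ` ?J" by (rule imageI)
        then show False using t by simp
      qed
    qed
    \<comment> \<open>The symmetric interval has the extra point \<open>- t\<close>, where the slope does not jump.\<close>
    have "s \<in> {- t<..t} \<longleftrightarrow> \<bar>s\<bar> \<le> t" if "slope_jump f s \<noteq> 0" for s
    proof -
      have "s \<noteq> - t" using that jump(2) by metis
      then show ?thesis by auto
    qed
    then have "{s. s \<in> {- t<..t} \<and> slope_jump f s \<noteq> 0} = {s. \<bar>s\<bar> \<le> t \<and> slope_jump f s \<noteq> 0}"
      by blast
    then have "right_slope f t - right_slope f (- t) = ?n t"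
      using right_slope_eq_sum_jumps[OF f, of "- t" t] t by simp
    moreover have "((\<lambda>t. f t + f (- t)) has_real_derivative right_slope f t - right_slope f (- t)) (at t)"
      using DERIV_add[OF smooth[OF jump(1)] DERIV_mirror[THEN iffD1, OF smooth[OF jump(2)]]] by simp
    ultimately show ?thesis
      by (simp add: has_real_derivative_iff_has_vector_derivative)
  qed
  have "continuous_on {0..r} (\<lambda>t. f t + f (- t))"
    by (intro continuous_intros cont continuous_on_compose2[OF cont[of UNIV]]) auto
  then have "(?n has_integral (f r + f (- r)) - (f 0 + f (- 0))) {0..r}"
    by (intro fundamental_theorem_of_calculus_interior_strong[OF fin \<open>r \<ge> 0\<close> deriv])
  then show ?thesis by (simp add: algebra_simps)
qed

section \<open>Comparison of the two characteristics\<close>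

lemma slope_jump_diff:
  assumes "tropical_meromorphic h" "tropical_meromorphic g"
  shows "slope_jump (\<lambda>x. h x - g x) x = slope_jump h x - slope_jump g x"
proof -
  obtain p q where h: "kink h x p q" using tropical_meromorphic_kink[OF assms(1)] .
  obtain p' q' where g: "kink g x p' q'" using tropical_meromorphic_kink[OF assms(2)] .
  show ?thesis
    using kink_slope_jump[OF kink_diff[OF h g]] kink_slope_jump[OF h] kink_slope_jump[OF g] by simp
qed

text \<open>
  The jump of the quotient is the jump of \<open>h\<close> minus that of \<open>g\<close>. Both are nonnegative and
  never positive together, so the difference is negative exactly at the roots of \<open>g\<close>, where
  its absolute value is the jump of \<open>g\<close>.
\<close>
lemma pole_count_quotient:
  assumes "tropical_entire g" "tropical_entire h" "no_common_root g h"
  shows "pole_count t (\<lambda>x. h x - g x) = (\<Sum>s | \<bar>s\<bar> \<le> t \<and> slope_jump g s \<noteq> 0. slope_jump g s)"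
proof -
  have mero: "tropical_meromorphic g" "tropical_meromorphic h"
    and pos: "\<And>x. slope_jump g x \<ge> 0" "\<And>x. slope_jump h x \<ge> 0"
    using assms(1,2) by (auto simp: tropical_entire_def tropical_pole_def not_less)
  have cases: "slope_jump g x = 0 \<or> slope_jump h x = 0" for x
  proof -
    have "\<not> (slope_jump g x > 0 \<and> slope_jump h x > 0)"
      using assms(3) by (simp add: no_common_root_def tropical_root_def)
    then show ?thesis using pos[of x] by linarith
  qed
  show ?thesis
    unfolding pole_count_def tropical_pole_def slope_jump_diff[OF mero(2,1)]
  proof (rule sum.cong)
    show "{s. \<bar>s\<bar> \<le> t \<and> slope_jump h s - slope_jump g s < 0} =
        {s. \<bar>s\<bar> \<le> t \<and> slope_jump g s \<noteq> 0}"
      using cases pos by (smt (verit) Collect_cong)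
    show "\<bar>slope_jump h s - slope_jump g s\<bar> = slope_jump g s"
      if "s \<in> {s. \<bar>s\<bar> \<le> t \<and> slope_jump g s \<noteq> 0}" for s
      using that cases[of s] pos(1)[of s] by auto
  qed
qed

lemma cartan_characteristic_pair_eq_nevanlinna:
  assumes "tropical_entire g" "tropical_entire h" "no_common_root g h"
    and "h 0 = g 0" and "r \<ge> 0"
  shows "cartan_characteristic_pair g h r = nevanlinna_characteristic r (\<lambda>x. h x - g x)"
proof -
  have "integral {0..r} (\<lambda>t. pole_count t (\<lambda>x. h x - g x)) = g r + g (- r) - 2 * g 0"
    unfolding pole_count_quotient[OF assms(1-3)]
    using assms(1,5) by (intro integral_unique tropical_jensen) (auto simp: tropical_entire_def)
  moreover have "max (g x) (h x) = g x + max 0 (h x - g x)" for x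
    by auto
  ultimately show ?thesis
    \<comment> \<open>At \<open>0\<close> the maximum is \<open>g 0\<close> by hypothesis, so only the positive parts at
      \<open>r\<close> and \<open>- r\<close> contribute beyond \<open>g\<close>.\<close>
    using assms(4) by (simp add: cartan_characteristic_pair_def nevanlinna_characteristic_def
        proximity_def integrated_pole_count_def field_simps)
qed

text \<open>The common translation of the homogeneous coordinates cancels in their difference.\<close>
lemma tp1_curve_eq_imp_diff_eq:
  assumes "tp1_curve g h = tp1_curve g' h'"
  shows "h x - g x = h' x - g' x"
proof -
  have "tp1_rel `` {(ereal (g x), ereal (h x))} = tp1_rel `` {(ereal (g' x), ereal (h' x))}"
    using fun_cong[OF assms, of x] by (simp add: tp1_curve_def)
  then have "((ereal (g x), ereal (h x)), (ereal (g' x), ereal (h' x))) \<in> tp1_rel"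
    by (rule eq_equiv_class[OF _ equiv_tp1_rel]) (simp add: tp1_coords_def)
  then show ?thesis
    by (auto simp: tp1_rel_def)
qed

theorem proposition4p4:
  fixes f g h :: "real \<Rightarrow> real" and r :: real
  assumes "tropical_meromorphic f"
    and "tropical_entire g" and "tropical_entire h"
    and "no_common_root g h"
    and "f = (\<lambda>x. h x - g x)"
    and "f 0 = 0"
    and "r \<ge> 0"
  shows "reduced_representation (tp1_curve g h) g h \<and>
    cartan_characteristic_pair g h r = cartan_characteristic (tp1_curve g h) r \<and>
    cartan_characteristic (tp1_curve g h) r = nevanlinna_characteristic r f"
proof -
  have red: "reduced_representation (tp1_curve g h) g h"
    using assms(2-4) by (simp add: reduced_representation_def)
  have all: "cartan_characteristic_pair g' h' r = nevanlinna_characteristic r f"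
    if "reduced_representation (tp1_curve g h) g' h'" for g' h'
  proof -
    have "f = (\<lambda>x. h' x - g' x)"
      using tp1_curve_eq_imp_diff_eq[of g h g' h'] that assms(5)
      by (auto simp: reduced_representation_def)
    then show ?thesis
      using cartan_characteristic_pair_eq_nevanlinna[of g' h' r] that assms(6,7)
      by (simp add: reduced_representation_def)
  qed
  have "cartan_characteristic (tp1_curve g h) r = nevanlinna_characteristic r f"
    unfolding cartan_characteristic_def
    using red all by (intro the_equality) metis+
  then show ?thesis
    using red all[OF red] by simp
qed

end
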